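(* Let $\mathbb{P}$ be a Feller transition kernel on $E$ having a unique invariant probability measure $\nu$. Assume there exists a compact set $K\subset E$ such that: (1) there is $\epsilon>0$ such that $\nu(K_\epsilon)=0$, where $K_\epsilon:=\{x\in E:\rho(x,K)\le\epsilon\}$; (2) there is $h\in(0,1)$ such that $\sup_{x\in K}\mathbb{P}_x\left[\tau_{K^c}>n\right]>h^n$ for all $n\in\mathbb{N}$. Then there exists $g\in C(E)$ for which no bounded solution to the Multiplicative Poisson Equation exists.
   Context: $(E,\mathcal{E})$ is a locally compact separable metric space with metric $\rho$ and Borel $\sigma$-field $\mathcal{E}$; $\rho(x,K):=\inf_{y\in K}\rho(x,y)$; $C(E)$ is the space of continuous bounded functions $E\to\mathbb{R}$. A Feller transition kernel $\mathbb{P}$ on $E$ is a probability transition kernel such that $x\mapsto\int_E f(y)\,\mathbb{P}(x,dy)$ is continuous for every $f\in C(E)$. $\mathbb{P}_x$ is the law of the Markov process $(x_i)_{i\ge0}$ with kernel $\mathbb{P}$ and $x_0=x$. For $B\in\mathcal{E}$, $\tau_B:=\inf\{n\in\mathbb{N}:x_n\in B\}$, with $\mathbb{N}=\{1,2,\ldots\}$ and $\inf\emptyset=+\infty$; $K^c=E\setminus K$. A bounded solution to the Multiplicative Poisson Equation (MPE) for $g$ is a pair $(w,\lambda)\in C(E)\times\mathbb{R}$ with $$w(x)=g(x)-\lambda+\ln\int_E e^{w(y)}\,\mathbb{P}(x,dy),\quad x\in E.$$ *)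

theory Defs
  imports "HOL-Probability.Probability"
begin

text \<open>
  The state space \<open>E\<close> is the carrier of the type \<open>'a\<close>, and \<open>C(E)\<close> is the set \<^const>\<open>bcontfun\<close>
  of bounded continuous functions.
\<close>

definition feller_kernel :: "('a::metric_space \<Rightarrow> 'a measure) \<Rightarrow> bool" where
  "feller_kernel P \<longleftrightarrow> P \<in> borel \<rightarrow>\<^sub>M prob_algebra borel \<and>
    (\<forall>f :: 'a \<Rightarrow> real. f \<in> bcontfun \<longrightarrow> continuous_on UNIV (\<lambda>x. \<integral>y. f y \<partial>P x))"

definition invariant_prob :: "('a::metric_space \<Rightarrow> 'a measure) \<Rightarrow> 'a measure \<Rightarrow> bool" where
  "invariant_prob P \<nu> \<longleftrightarrow> prob_space \<nu> \<and> sets \<nu> = sets borel \<and>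
    (\<forall>A\<in>sets borel. emeasure \<nu> A = (\<integral>\<^sup>+x. emeasure (P x) A \<partial>\<nu>))"

text \<open>
  The law of the Markov chain \<open>(\<omega> 0, \<omega> 1, \<dots>)\<close> with kernel \<open>P\<close> started at \<open>x\<close>, on the path
  space \<open>nat \<Rightarrow> 'a\<close> with the product \<open>\<sigma>\<close>-algebra, is the Ionescu-Tulcea extension of the following
  conditional laws of the \<open>n\<close>-th coordinate given the earlier ones.
\<close>

definition chain_step :: "('a::metric_space \<Rightarrow> 'a measure) \<Rightarrow> 'a \<Rightarrow> nat \<Rightarrow> (nat \<Rightarrow> 'a) \<Rightarrow> 'a measure" where
  "chain_step P x n \<omega> = (case n of 0 \<Rightarrow> return borel x | Suc m \<Rightarrow> P (\<omega> m))"

definition chain_law :: "('a::metric_space \<Rightarrow> 'a measure) \<Rightarrow> 'a \<Rightarrow> (nat \<Rightarrow> 'a) measure" where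
  "chain_law P x =
    projective_family.lim UNIV (Ionescu_Tulcea.CI (chain_step P x) (\<lambda>_. borel)) (\<lambda>_. borel)"

text \<open>Times range over \<open>{1, 2, \<dots>}\<close>; the infimum of the empty set is \<open>\<infinity>\<close>.\<close>

definition hit_time :: "'a set \<Rightarrow> (nat \<Rightarrow> 'a) \<Rightarrow> enat" where
  "hit_time B \<omega> = Inf {enat n | n. 1 \<le> n \<and> \<omega> n \<in> B}"

lemma less_hit_time_iff: "enat n < hit_time B \<omega> \<longleftrightarrow> (\<forall>i\<in>{1..n}. \<omega> i \<notin> B)"
proof
  assume less: "enat n < hit_time B \<omega>"
  show "\<forall>i\<in>{1..n}. \<omega> i \<notin> B"
  proof (intro ballI notI)
    fix i assume "i \<in> {1..n}" "\<omega> i \<in> B"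
    then have "hit_time B \<omega> \<le> enat i"
      unfolding hit_time_def by (intro Inf_lower) auto
    also have "\<dots> \<le> enat n"
      using \<open>i \<in> {1..n}\<close> by simp
    finally show False
      using less by simp
  qed
next
  assume none: "\<forall>i\<in>{1..n}. \<omega> i \<notin> B"
  have "enat (Suc n) \<le> hit_time B \<omega>"
    unfolding hit_time_def
  proof (rule Inf_greatest)
    fix t assume "t \<in> {enat i | i. 1 \<le> i \<and> \<omega> i \<in> B}"
    then obtain i where i: "t = enat i" "1 \<le> i" "\<omega> i \<in> B"
      by blast
    with none have "\<not> i \<le> n"
      by (meson atLeastAtMost_iff)
    with i show "enat (Suc n) \<le> t"
      by simp
  qed
  then show "enat n < hit_time B \<omega>"
    by (metis Suc_ile_eq)
qed

definition bounded_MPE_solution ::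
    "('a::metric_space \<Rightarrow> 'a measure) \<Rightarrow> ('a \<Rightarrow> real) \<Rightarrow> ('a \<Rightarrow> real) \<Rightarrow> real \<Rightarrow> bool" where
  "bounded_MPE_solution P g w l \<longleftrightarrow> w \<in> bcontfun \<and>
    (\<forall>x. w x = g x - l + ln (\<integral>y. exp (w y) \<partial>P x))"

text \<open>
  The law \<open>chain_law\<close> is a probability measure under which the path starts at \<open>x\<close> and has the
  Markov property with kernel \<open>P\<close>.
\<close>

lemma Ionescu_Tulcea_chain_step:
  assumes P: "P \<in> borel \<rightarrow>\<^sub>M prob_algebra borel"
  shows "Ionescu_Tulcea (chain_step P x) (\<lambda>_. borel)"
proof (rule Ionescu_Tulcea.intro)
  have P': "P \<in> borel \<rightarrow>\<^sub>M subprob_algebra borel"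
    by (rule measurable_prob_algebraD[OF P])
  show "chain_step P x i \<in> Pi\<^sub>M {0..<i} (\<lambda>_. borel) \<rightarrow>\<^sub>M subprob_algebra borel" for i
  proof (cases i)
    case 0
    then show ?thesis
      by (simp add: chain_step_def[abs_def] space_subprob_algebra prob_space_return
          prob_space_imp_subprob_space)
  next
    case (Suc m)
    have "(\<lambda>\<omega>. P (\<omega> m)) \<in> Pi\<^sub>M {0..<i} (\<lambda>_. borel) \<rightarrow>\<^sub>M subprob_algebra borel"
      by (rule measurable_compose[OF _ P'], rule measurable_component_singleton) (simp add: Suc)
    then show ?thesis
      by (simp add: chain_step_def[abs_def] Suc)
  qed
  show "prob_space (chain_step P x i \<omega>)" for i \<omega>
    using measurable_space[OF P]
    by (auto simp: chain_step_def space_prob_algebra prob_space_return split: nat.split)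
qed

lemma sets_chain_law:
  assumes "P \<in> borel \<rightarrow>\<^sub>M prob_algebra borel"
  shows "sets (chain_law P x) = sets (Pi\<^sub>M UNIV (\<lambda>_. borel))"
proof -
  interpret Ionescu_Tulcea "chain_step P x" "\<lambda>_. borel"
    by (rule Ionescu_Tulcea_chain_step[OF assms])
  show ?thesis
    by (simp add: chain_law_def)
qed

lemma distr_chain_law:
  assumes "P \<in> borel \<rightarrow>\<^sub>M prob_algebra borel"
  shows "distr (chain_law P x) (Pi\<^sub>M {0..<n} (\<lambda>_. borel)) (\<lambda>\<omega>. restrict \<omega> {0..<n}) =
    Ionescu_Tulcea.C (chain_step P x) (\<lambda>_. borel) 0 n (\<lambda>_. undefined)"
proof -
  interpret Ionescu_Tulcea "chain_step P x" "\<lambda>_. borel"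
    by (rule Ionescu_Tulcea_chain_step[OF assms])
  have le: "up_to {0..<n} \<le> n"
    by (simp add: up_to_iff_Ico)
  moreover have "n \<le> up_to {0..<n}"
    using up_to[of "{0..<n}"] by (cases n) auto
  ultimately have *: "up_to {0..<n} = n"
    by simp
  have "CI {0..<n} = C 0 n (\<lambda>_. undefined)"
    using distr_C[of n n "\<lambda>_. undefined" 0] by (simp add: CI_def *)
  then show ?thesis
    unfolding chain_law_def by (subst distr_lim) simp_all
qed

lemma prob_space_chain_law:
  assumes "P \<in> borel \<rightarrow>\<^sub>M prob_algebra borel"
  shows "prob_space (chain_law P x)"
proof -
  interpret Ionescu_Tulcea "chain_step P x" "\<lambda>_. borel"
    by (rule Ionescu_Tulcea_chain_step[OF assms])
  show ?thesis
  proof (rule prob_space_distrD)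
    show "(\<lambda>\<omega>. restrict \<omega> {0..<0}) \<in> chain_law P x \<rightarrow>\<^sub>M Pi\<^sub>M {0..<0} (\<lambda>_. borel)"
      unfolding measurable_cong_sets[OF sets_chain_law[OF assms] refl]
      by (rule measurable_restrict_subset) simp
    show "prob_space (distr (chain_law P x) (Pi\<^sub>M {0..<0} (\<lambda>_. borel)) (\<lambda>\<omega>. restrict \<omega> {0..<0}))"
      unfolding distr_chain_law[OF assms] by (rule prob_space_C) (simp add: space_PiM)
  qed
qed

lemma nn_integral_chain_law:
  assumes P: "P \<in> borel \<rightarrow>\<^sub>M prob_algebra borel"
    and f: "f \<in> borel_measurable (Pi\<^sub>M {0..<n} (\<lambda>_. borel))"
  shows "(\<integral>\<^sup>+\<omega>. f (restrict \<omega> {0..<n}) \<partial>chain_law P x) =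
    (\<integral>\<^sup>+\<omega>. f \<omega> \<partial>Ionescu_Tulcea.C (chain_step P x) (\<lambda>_. borel) 0 n (\<lambda>_. undefined))"
proof -
  have "(\<lambda>\<omega>. restrict \<omega> {0..<n}) \<in> chain_law P x \<rightarrow>\<^sub>M Pi\<^sub>M {0..<n} (\<lambda>_. borel)"
    by (auto simp: measurable_cong_sets[OF sets_chain_law[OF P] refl])
  with f show ?thesis
    by (simp add: distr_chain_law[OF P, symmetric] nn_integral_distr)
qed

lemma chain_law_start:
  fixes f :: "'a::metric_space \<Rightarrow> ennreal"
  assumes kernel: "P \<in> borel \<rightarrow>\<^sub>M prob_algebra borel" and f[measurable]: "f \<in> borel_measurable borel"
  shows "(\<integral>\<^sup>+\<omega>. f (\<omega> 0) \<partial>chain_law P x) = f x"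
proof -
  interpret Ionescu_Tulcea "chain_step P x" "\<lambda>_. borel"
    by (rule Ionescu_Tulcea_chain_step[OF kernel])
  have m: "(\<lambda>\<omega>. f (\<omega> 0)) \<in> borel_measurable (Pi\<^sub>M {0..<1::nat} (\<lambda>_. borel))"
    by (rule measurable_compose[OF _ f], rule measurable_component_singleton) simp
  have "C 0 1 (\<lambda>_. undefined) = eP 0 (\<lambda>_. undefined)"
    using bind_return[OF measurable_eP[of 0], of "\<lambda>_. undefined"] by simp
  moreover have "(\<integral>\<^sup>+\<omega>. f (\<omega> 0) \<partial>eP 0 (\<lambda>_. undefined)) = f x"
    using m by (subst nn_integral_eP) (auto simp: chain_step_def nn_integral_return)
  ultimately show ?thesis
    using nn_integral_chain_law[OF kernel m, of x] by simp
qed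

lemma chain_law_Markov:
  fixes f :: "(nat \<Rightarrow> 'a::metric_space) \<Rightarrow> ennreal"
  assumes kernel: "P \<in> borel \<rightarrow>\<^sub>M prob_algebra borel"
    and f[measurable]: "f \<in> borel_measurable (Pi\<^sub>M {0..<Suc (Suc n)} (\<lambda>_. borel))"
  shows "(\<integral>\<^sup>+\<omega>. f (restrict \<omega> {0..<Suc (Suc n)}) \<partial>chain_law P x) =
    (\<integral>\<^sup>+\<omega>. (\<integral>\<^sup>+y. f ((restrict \<omega> {0..<Suc n})(Suc n := y)) \<partial>P (\<omega> n)) \<partial>chain_law P x)"
proof -
  interpret Ionescu_Tulcea "chain_step P x" "\<lambda>_. borel"
    by (rule Ionescu_Tulcea_chain_step[OF kernel])
  define g where "g \<omega> = (\<integral>\<^sup>+\<xi>. f \<xi> \<partial>eP (Suc n) \<omega>)" for \<omega>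
  have g: "g \<in> borel_measurable (Pi\<^sub>M {0..<Suc n} (\<lambda>_. borel))"
    unfolding g_def
    by (rule measurable_compose[OF measurable_eP nn_integral_measurable_subprob_algebra[OF f]])
  have g_eq: "g (restrict \<omega> {0..<Suc n}) =
      (\<integral>\<^sup>+y. f ((restrict \<omega> {0..<Suc n})(Suc n := y)) \<partial>P (\<omega> n))" for \<omega>
    unfolding g_def by (subst nn_integral_eP[OF _ f]) (auto simp: space_PiM chain_step_def)
  have "(\<integral>\<^sup>+\<omega>. f (restrict \<omega> {0..<Suc (Suc n)}) \<partial>chain_law P x) =
      (\<integral>\<^sup>+\<omega>. f \<omega> \<partial>(C 0 (Suc n) (\<lambda>_. undefined) \<bind> eP (Suc n)))"
    using nn_integral_chain_law[OF kernel f, of x] by simp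
  also have "\<dots> = (\<integral>\<^sup>+\<omega>. g \<omega> \<partial>C 0 (Suc n) (\<lambda>_. undefined))"
    unfolding g_def
    using measurable_eP[of "Suc n"] sets_C[of "\<lambda>_. undefined" 0 "Suc n"]
    by (intro nn_integral_bind[OF f])
       (simp add: measurable_cong_sets[OF sets_C[of "\<lambda>_. undefined" 0 "Suc n"] refl] del: C.simps)
  also have "\<dots> = (\<integral>\<^sup>+\<omega>. g (restrict \<omega> {0..<Suc n}) \<partial>chain_law P x)"
    by (rule nn_integral_chain_law[OF kernel g, symmetric])
  finally show ?thesis
    by (simp only: g_eq)
qed

end

theory Submission
  imports Defs
begin

text \<open>
  Put \<open>u = exp \<circ> w\<close>. The Multiplicative Poisson Equation says that \<open>u\<close> is a positive eigenfunction,
  \<open>u = exp (g - \<lambda>) \<cdot> P u\<close>, and two different parts of the state space constrain the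
  eigenvalue in incompatible ways when \<open>g\<close> is a sufficiently high bump over \<open>K\<close> that vanishes
  off the \<open>\<epsilon>\<close>-neighbourhood of \<open>K\<close>.

  On the one hand, \<open>g = 0\<close> holds \<open>\<nu>\<close>-almost everywhere. Integrating the equation against
  \<open>\<nu>\<close>, invariance gives \<open>\<integral>u d\<nu> = exp (- \<lambda>) \<integral>u d\<nu>\<close>, and since this integral is positive
  and finite, \<open>\<lambda> = 0\<close> (\<open>MPE_eigenvalue_zero\<close>).

  On the other hand, \<open>g = - 2 ln h\<close> on \<open>K\<close>, so with \<open>\<lambda> = 0\<close> every step that the chain
  makes from a point of \<open>K\<close> multiplies the expectation of \<open>u\<close> by \<open>h\<^sup>2\<close>. Thus the
  expectation of \<open>u\<close> over paths that remain in \<open>K\<close> up to time \<open>n\<close> is at most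
  \<open>h ^ (2 * n) * sup u\<close> (\<open>killed_supermartingale\<close>). It is at least \<open>inf u\<close> times the probability of
  survival (\<open>survival_bound\<close>), and by assumption this probability exceeds \<open>h ^ n\<close> for a
  suitable starting point in \<open>K\<close>. So \<open>inf u \<le> h ^ n * sup u\<close> for all \<open>n\<close>, which is absurd because \<open>w\<close> is bounded.
\<close>

lemma feller_kernelD:
  assumes "feller_kernel P"
  shows "P \<in> borel \<rightarrow>\<^sub>M prob_algebra borel" "prob_space (P x)" "sets (P x) = sets borel"
proof -
  show P: "P \<in> borel \<rightarrow>\<^sub>M prob_algebra borel"
    using assms by (simp add: feller_kernel_def)
  have "P x \<in> space (prob_algebra borel)"
    using measurable_space[OF P] by simp
  then show "prob_space (P x)" "sets (P x) = sets borel"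
    by (auto simp: space_prob_algebra)
qed

lemma nn_integral_invariant_prob:
  assumes kernel: "P \<in> borel \<rightarrow>\<^sub>M prob_algebra borel" and inv: "invariant_prob P \<nu>"
    and f: "f \<in> borel_measurable borel"
  shows "(\<integral>\<^sup>+x. \<integral>\<^sup>+y. f y \<partial>P x \<partial>\<nu>) = (\<integral>\<^sup>+x. f x \<partial>\<nu>)"
proof -
  interpret prob_space \<nu>
    using inv by (simp add: invariant_prob_def)
  have sets: "sets \<nu> = sets borel"
    and eq: "\<And>A. A \<in> sets borel \<Longrightarrow> emeasure \<nu> A = (\<integral>\<^sup>+x. emeasure (P x) A \<partial>\<nu>)"
    using inv by (auto simp: invariant_prob_def)
  have P: "P \<in> \<nu> \<rightarrow>\<^sub>M subprob_algebra borel"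
    using measurable_prob_algebraD[OF kernel] by (simp add: measurable_cong_sets[OF sets refl])
  have "\<nu> = \<nu> \<bind> P"
  proof (rule measure_eqI)
    show "sets \<nu> = sets (\<nu> \<bind> P)"
      by (simp add: sets sets_bind[OF sets_kernel[OF P] not_empty])
  next
    fix A assume "A \<in> sets \<nu>"
    then show "emeasure \<nu> A = emeasure (\<nu> \<bind> P) A"
      by (simp add: sets eq emeasure_bind[OF not_empty P])
  qed
  then show ?thesis
    using nn_integral_bind[OF f P] by simp
qed

text \<open>
  The eigenfunction form of the equation. Boundedness of \<open>w\<close> makes the integral of \<open>exp \<circ> w\<close>
  finite and positive, so that \<open>exp\<close> really inverts the logarithm. Values are taken in the extended
  nonnegative reals because invariance and the Markov property are statements about nonnegative
  integrals.
\<close>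

lemma MPE_solution_exp:
  assumes feller: "feller_kernel P" and sol: "bounded_MPE_solution P g w l"
  shows "ennreal (exp (w x)) = ennreal (exp (g x - l)) * (\<integral>\<^sup>+y. ennreal (exp (w y)) \<partial>P x)"
proof -
  interpret prob_space "P x"
    by (rule feller_kernelD[OF feller])
  have w: "w \<in> bcontfun" and eq: "w x = g x - l + ln (\<integral>y. exp (w y) \<partial>P x)"
    using sol unfolding bounded_MPE_solution_def by blast+
  obtain B where B: "\<And>y. \<bar>w y\<bar> \<le> B"
    using w by (auto simp: bcontfun_def bounded_iff)
  have "w \<in> borel_measurable borel"
    using w by (intro borel_measurable_continuous_onI) (simp add: bcontfun_def)
  then have [measurable]: "w \<in> borel_measurable (P x)"
    by (simp add: measurable_cong_sets[OF feller_kernelD(3)[OF feller] refl])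
  have int: "integrable (P x) (\<lambda>y. exp (w y))"
  proof (rule integrable_const_bound[of _ "exp B"])
    show "AE y in P x. norm (exp (w y)) \<le> exp B"
      using B by (auto simp: abs_le_iff)
  qed simp
  have "exp (- B) \<le> (\<integral>y. exp (w y) \<partial>P x)"
    by (intro integral_ge_const int AE_I2) (use B in \<open>simp add: abs_le_iff minus_le_iff\<close>)
  then have "0 < (\<integral>y. exp (w y) \<partial>P x)"
    using exp_gt_zero[of "- B"] by linarith
  then have "exp (w x) = exp (g x - l) * (\<integral>y. exp (w y) \<partial>P x)"
    by (subst eq) (simp add: exp_add)
  moreover have "(\<integral>\<^sup>+y. ennreal (exp (w y)) \<partial>P x) = ennreal (\<integral>y. exp (w y) \<partial>P x)"
    by (rule nn_integral_eq_integral[OF int]) simp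
  ultimately show ?thesis
    by (simp add: ennreal_mult')
qed

text \<open>
  The stationary chain never sees \<open>g\<close>: \<open>\<nu>\<close>-almost everywhere \<open>u = exp (- l) \<cdot> P u\<close>, and
  \<open>P\<close> preserves the integral of \<open>u\<close> against \<open>\<nu>\<close>. The bounds on \<open>w\<close> make this integral
  positive and finite, so that it can be cancelled.
\<close>

lemma MPE_eigenvalue_zero:
  assumes feller: "feller_kernel P" and inv: "invariant_prob P \<nu>"
    and g: "AE x in \<nu>. g x = 0" and sol: "bounded_MPE_solution P g w l"
  shows "l = 0"
proof -
  interpret prob_space \<nu>
    using inv by (simp add: invariant_prob_def)
  note kernel = feller_kernelD(1)[OF feller]
  have sets: "sets \<nu> = sets borel"
    using inv by (simp add: invariant_prob_def)
  have w: "w \<in> bcontfun"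
    using sol unfolding bounded_MPE_solution_def by blast
  obtain B where B: "\<And>y. \<bar>w y\<bar> \<le> B"
    using w by (auto simp: bcontfun_def bounded_iff)
  have w_meas[measurable]: "w \<in> borel_measurable borel"
    using w by (intro borel_measurable_continuous_onI) (simp add: bcontfun_def)
  have Pu: "(\<lambda>x. \<integral>\<^sup>+y. ennreal (exp (w y)) \<partial>P x) \<in> borel_measurable borel"
    by (rule measurable_compose[OF measurable_prob_algebraD[OF kernel]
          nn_integral_measurable_subprob_algebra]) simp
  define I where "I = (\<integral>\<^sup>+x. ennreal (exp (w x)) \<partial>\<nu>)"
  have "I = (\<integral>\<^sup>+x. ennreal (exp (g x - l)) * (\<integral>\<^sup>+y. ennreal (exp (w y)) \<partial>P x) \<partial>\<nu>)"
    unfolding I_def by (subst MPE_solution_exp[OF feller sol]) simp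
  also have "\<dots> = (\<integral>\<^sup>+x. ennreal (exp (- l)) * (\<integral>\<^sup>+y. ennreal (exp (w y)) \<partial>P x) \<partial>\<nu>)"
    using g by (intro nn_integral_cong_AE) auto
  also have "\<dots> = ennreal (exp (- l)) * I"
    unfolding I_def
    by (subst nn_integral_cmult)
       (simp_all add: Pu measurable_cong_sets[OF sets refl] nn_integral_invariant_prob[OF kernel inv])
  finally have I: "ennreal (exp (- l)) * I = I"
    by (rule sym)
  have "(\<integral>\<^sup>+x. ennreal (exp (- B)) \<partial>\<nu>) \<le> I"
    unfolding I_def using B
    by (intro nn_integral_mono ennreal_leI) (simp add: abs_le_iff minus_le_iff)
  then have pos: "0 < I"
    by (rule less_le_trans[rotated]) (simp add: emeasure_space_1)
  have "I \<le> (\<integral>\<^sup>+x. ennreal (exp B) \<partial>\<nu>)"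
    unfolding I_def using B by (intro nn_integral_mono ennreal_leI) (simp add: abs_le_iff)
  then have fin: "I < \<top>"
    by (rule le_less_trans) (simp add: emeasure_space_1)
  obtain r where r: "I = ennreal r" "0 < r"
    using pos fin by (cases I) auto
  then have "ennreal (exp (- l) * r) = ennreal r"
    using I by (simp only: ennreal_mult' exp_ge_zero)
  then have "exp (- l) * r = r"
    using r by (subst (asm) ennreal_inj) auto
  with r have "exp (- l) = 1"
    by (metis mult_cancel_right1 less_irrefl)
  then show ?thesis
    by simp
qed

text \<open>
  From a point of \<open>K\<close>, one step of the chain multiplies the expectation of \<open>u\<close> by at most
  \<open>1 / a\<close>, and killing the chain on leaving \<open>K\<close> only lowers the expectation. So the process
  \<open>a ^ n * u (\<omega> n)\<close>, killed on leaving \<open>K\<close>, is a supermartingale; by the Markov property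
  at time \<open>n\<close> its expectation decreases.
\<close>

lemma killed_supermartingale:
  fixes u :: "'a::metric_space \<Rightarrow> ennreal"
  assumes kernel: "P \<in> borel \<rightarrow>\<^sub>M prob_algebra borel"
    and K[measurable]: "K \<in> sets borel" and u[measurable]: "u \<in> borel_measurable borel"
    and super: "\<And>y. y \<in> K \<Longrightarrow> a * (\<integral>\<^sup>+z. u z \<partial>P y) \<le> u y"
  shows "a ^ n * (\<integral>\<^sup>+\<omega>. (\<Prod>i\<le>n. indicator K (\<omega> i)) * u (\<omega> n) \<partial>chain_law P x) \<le> u x"
proof -
  have [measurable]: "(\<lambda>\<omega>. \<omega> i) \<in> chain_law P x \<rightarrow>\<^sub>M borel" for i
    unfolding measurable_cong_sets[OF sets_chain_law[OF kernel] refl]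
    by (rule measurable_component_singleton) simp
  show ?thesis
  proof (induction n)
    case 0
    have "(\<integral>\<^sup>+\<omega>. indicator K (\<omega> 0) * u (\<omega> 0) \<partial>chain_law P x) = indicator K x * u x"
      by (rule chain_law_start[OF kernel]) simp
    then show ?case
      by (simp add: indicator_def)
  next
    case (Suc n)
    define f :: "(nat \<Rightarrow> 'a) \<Rightarrow> ennreal"
      where "f \<omega> = (\<Prod>i\<le>Suc n. indicator K (\<omega> i)) * u (\<omega> (Suc n))" for \<omega>
    have f: "f \<in> borel_measurable (Pi\<^sub>M {0..<Suc (Suc n)} (\<lambda>_. borel))"
    proof -
      have [measurable]: "(\<lambda>\<omega>. \<omega> i) \<in> Pi\<^sub>M {0..<Suc (Suc n)} (\<lambda>_. borel) \<rightarrow>\<^sub>M (borel :: 'a measure)"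
        if "i \<le> Suc n" for i
        by (rule measurable_component_singleton) (use that in simp)
      show ?thesis
        unfolding f_def
        by (intro borel_measurable_times_ennreal borel_measurable_prod_ennreal) measurable
    qed
    \<comment> \<open>\<open>v z\<close> is the expectation of \<open>u\<close> after one killed step from \<open>z\<close>.\<close>
    define v where "v z = (\<integral>\<^sup>+y. indicator K y * u y \<partial>P z)" for z
    have v[measurable]: "v \<in> borel_measurable borel"
      unfolding v_def
      by (rule measurable_compose[OF measurable_prob_algebraD[OF kernel]
            nn_integral_measurable_subprob_algebra]) simp
    have sets_P: "sets (P z) = sets borel" for z
      using measurable_space[OF kernel, of z] by (simp add: space_prob_algebra)
    have "(\<integral>\<^sup>+\<omega>. (\<Prod>i\<le>Suc n. indicator K (\<omega> i)) * u (\<omega> (Suc n)) \<partial>chain_law P x)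
        = (\<integral>\<^sup>+\<omega>. f (restrict \<omega> {0..<Suc (Suc n)}) \<partial>chain_law P x)"
      by (simp add: f_def cong: prod.cong_simp)
    also have "\<dots> = (\<integral>\<^sup>+\<omega>. (\<integral>\<^sup>+y. f ((restrict \<omega> {0..<Suc n})(Suc n := y)) \<partial>P (\<omega> n)) \<partial>chain_law P x)"
      by (rule chain_law_Markov[OF kernel f])
    also have "\<dots> = (\<integral>\<^sup>+\<omega>. (\<Prod>i\<le>n. indicator K (\<omega> i)) * v (\<omega> n) \<partial>chain_law P x)"
    proof (rule nn_integral_cong)
      fix \<omega> :: "nat \<Rightarrow> 'a"
      have "f ((restrict \<omega> {0..<Suc n})(Suc n := y))
          = (\<Prod>i\<le>n. indicator K (\<omega> i)) * (indicator K y * u y)" for y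
        by (simp add: f_def mult.assoc cong: prod.cong_simp)
      then show "(\<integral>\<^sup>+y. f ((restrict \<omega> {0..<Suc n})(Suc n := y)) \<partial>P (\<omega> n))
          = (\<Prod>i\<le>n. indicator K (\<omega> i)) * v (\<omega> n)"
        by (simp add: v_def nn_integral_cmult measurable_cong_sets[OF sets_P refl])
    qed
    finally have "a * (\<integral>\<^sup>+\<omega>. (\<Prod>i\<le>Suc n. indicator K (\<omega> i)) * u (\<omega> (Suc n)) \<partial>chain_law P x)
        = (\<integral>\<^sup>+\<omega>. a * ((\<Prod>i\<le>n. indicator K (\<omega> i)) * v (\<omega> n)) \<partial>chain_law P x)"
      by (simp add: nn_integral_cmult)
    also have "\<dots> \<le> (\<integral>\<^sup>+\<omega>. (\<Prod>i\<le>n. indicator K (\<omega> i)) * u (\<omega> n) \<partial>chain_law P x)"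
    proof (rule nn_integral_mono)
      fix \<omega> :: "nat \<Rightarrow> 'a"
      show "a * ((\<Prod>i\<le>n. indicator K (\<omega> i)) * v (\<omega> n)) \<le> (\<Prod>i\<le>n. indicator K (\<omega> i)) * u (\<omega> n)"
      proof (cases "\<omega> n \<in> K")
        case True
        have "v (\<omega> n) \<le> (\<integral>\<^sup>+y. u y \<partial>P (\<omega> n))"
          unfolding v_def by (intro nn_integral_mono) (simp add: indicator_def)
        then have "a * v (\<omega> n) \<le> u (\<omega> n)"
          using super[OF True] by (meson mult_left_mono order_trans zero_le)
        then show ?thesis
          by (subst mult.left_commute) (rule mult_left_mono, simp_all)
      next
        case False
        then have "(\<Prod>i\<le>n. indicator K (\<omega> i)) = (0 :: ennreal)"
          by (intro prod_zero bexI[of _ n]) simp_all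
        then show ?thesis
          by (simp only: mult_zero_left mult_zero_right order_refl)
      qed
    qed
    finally have "a ^ n * (a * (\<integral>\<^sup>+\<omega>. (\<Prod>i\<le>Suc n. indicator K (\<omega> i)) * u (\<omega> (Suc n)) \<partial>chain_law P x))
        \<le> u x"
      using Suc.IH by (meson mult_left_mono order_trans zero_le)
    then show ?case
      by (simp only: power_Suc mult_ac)
  qed
qed

text \<open>
  Bounding \<open>u\<close> below by \<open>m\<close> at time \<open>n\<close> turns the supermartingale inequality into a tail bound
  for the exit time. The supermartingale is killed already at time \<open>0\<close>, while the exit time counts
  from time \<open>1\<close>; for \<open>x \<in> K\<close> this makes no difference.
\<close>

lemma survival_bound:
  fixes u :: "'a::metric_space \<Rightarrow> ennreal"
  assumes kernel: "P \<in> borel \<rightarrow>\<^sub>M prob_algebra borel"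
    and K[measurable]: "K \<in> sets borel" and u: "u \<in> borel_measurable borel"
    and super: "\<And>y. y \<in> K \<Longrightarrow> a * (\<integral>\<^sup>+z. u z \<partial>P y) \<le> u y"
    and lower: "\<And>y. y \<in> K \<Longrightarrow> m \<le> u y" and "x \<in> K"
  shows "a ^ n * (m * emeasure (chain_law P x)
    {\<omega> \<in> space (chain_law P x). hit_time (- K) \<omega> > enat n}) \<le> u x"
proof -
  let ?M = "chain_law P x"
  let ?S = "{\<omega> \<in> space ?M. hit_time (- K) \<omega> > enat n}"
  have [measurable]: "(\<lambda>\<omega>. \<omega> i) \<in> ?M \<rightarrow>\<^sub>M borel" for i
    unfolding measurable_cong_sets[OF sets_chain_law[OF kernel] refl]
    by (rule measurable_component_singleton) simp
  have S: "?S = {\<omega> \<in> space ?M. \<forall>i\<in>{1..n}. \<omega> i \<in> K}"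
    by (simp add: less_hit_time_iff)
  have "?S \<in> sets ?M"
    unfolding S by measurable
  have "(\<integral>\<^sup>+\<omega>. indicator (- K) (\<omega> 0) \<partial>?M) = indicator (- K) x"
    by (rule chain_law_start[OF kernel]) simp
  then have "(\<integral>\<^sup>+\<omega>. indicator (- K) (\<omega> 0) \<partial>?M) = 0"
    using \<open>x \<in> K\<close> by simp
  then have "AE \<omega> in ?M. indicator (- K) (\<omega> 0) = (0 :: ennreal)"
    by (rule nn_integral_0_iff_AE[THEN iffD1, rotated]) simp
  then have start: "AE \<omega> in ?M. \<omega> 0 \<in> K"
    by eventually_elim (auto simp: indicator_def split: if_splits)
  have "m * emeasure ?M ?S = (\<integral>\<^sup>+\<omega>. m * indicator ?S \<omega> \<partial>?M)"
    using \<open>?S \<in> sets ?M\<close> by (simp add: nn_integral_cmult_indicator)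
  also have "\<dots> \<le> (\<integral>\<^sup>+\<omega>. (\<Prod>i\<le>n. indicator K (\<omega> i)) * u (\<omega> n) \<partial>?M)"
  proof (rule nn_integral_mono_AE, use start in eventually_elim)
    case (elim \<omega>)
    show ?case
    proof (cases "\<omega> \<in> ?S")
      case True
      then have "\<omega> i \<in> K" if "i \<le> n" for i
        using elim that unfolding S by (cases i) auto
      then show ?thesis
        using True lower by simp
    qed simp
  qed
  finally show ?thesis
    using killed_supermartingale[OF kernel K u super, of n x]
    by (meson mult_left_mono order_trans zero_le)
qed

theorem proposition6p2:
  fixes P :: "'a::metric_space \<Rightarrow> 'a measure"
    and \<nu> :: "'a measure"
    and K :: "'a set"
    and \<epsilon> h :: real
  assumes locally_compact: "locally_compact_space (euclidean :: 'a topology)"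
    and separable: "separable_space (euclidean :: 'a topology)"
    and feller: "feller_kernel P"
    and invariant: "invariant_prob P \<nu>"
    and unique: "\<And>\<mu>. invariant_prob P \<mu> \<Longrightarrow> \<mu> = \<nu>"
    and compact: "compact K"
    and "0 < \<epsilon>" and null: "emeasure \<nu> {x. infdist x K \<le> \<epsilon>} = 0"
    and "0 < h" "h < 1"
    and exit: "\<And>n::nat. 1 \<le> n \<Longrightarrow>
      (SUP x\<in>K. emeasure (chain_law P x) {\<omega> \<in> space (chain_law P x). hit_time (- K) \<omega> > enat n})
        > ennreal (h ^ n)"
  shows "\<exists>g :: 'a \<Rightarrow> real. g \<in> bcontfun \<and> \<not> (\<exists>w l. bounded_MPE_solution P g w l)"
proof -
  note kernel = feller_kernelD(1)[OF feller]
  have K: "K \<in> sets borel"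
    using compact by (intro borel_closed compact_imp_closed)
  \<comment> \<open>The value \<open>- ln h\<close> on \<open>K\<close> would only balance the survival probability \<open>h ^ n\<close>;
    twice that value leaves a factor \<open>h ^ n\<close> to spare.\<close>
  define g where "g x = - 2 * ln h * max 0 (1 - infdist x K / \<epsilon>)" for x :: 'a
  have "continuous_on UNIV g"
    unfolding g_def using \<open>0 < \<epsilon>\<close> by (intro continuous_intros) auto
  moreover have "bounded (range g)"
  proof -
    have "\<bar>g x\<bar> \<le> \<bar>2 * ln h\<bar>" for x
      using \<open>0 < \<epsilon>\<close> infdist_nonneg[of x K] by (auto simp: g_def abs_mult intro!: mult_left_le)
    then show ?thesis
      by (auto simp: bounded_iff)
  qed
  ultimately have g: "g \<in> bcontfun"
    by (simp add: bcontfun_def)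
  have "sets \<nu> = sets borel"
    using invariant by (simp add: invariant_prob_def)
  then have "{x. infdist x K \<le> \<epsilon>} \<in> null_sets \<nu>"
    using null by (auto simp: null_sets_def intro!: borel_closed closed_Collect_le continuous_intros)
  then have "AE x in \<nu>. x \<notin> {x. infdist x K \<le> \<epsilon>}"
    by (rule AE_not_in)
  then have g_null: "AE x in \<nu>. g x = 0"
    by eventually_elim (use \<open>0 < \<epsilon>\<close> in \<open>auto simp: g_def max_def field_simps\<close>)
  have False if sol: "bounded_MPE_solution P g w l" for w l
  proof -
    have "l = 0"
      by (rule MPE_eigenvalue_zero[OF feller invariant g_null sol])
    have w: "w \<in> bcontfun"
      using sol unfolding bounded_MPE_solution_def by blast
    obtain B where B: "\<And>y. \<bar>w y\<bar> \<le> B"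
      using w by (auto simp: bcontfun_def bounded_iff)
    have w_meas[measurable]: "w \<in> borel_measurable borel"
      using w by (intro borel_measurable_continuous_onI) (simp add: bcontfun_def)
    \<comment> \<open>As \<open>l = 0\<close>, this is the factor \<open>exp (g y - l)\<close> at the points \<open>y\<close> of \<open>K\<close>.\<close>
    define a where "a = inverse h ^ 2"
    have "0 < a"
      using \<open>0 < h\<close> by (simp add: a_def)
    have "exp (g y) = a" if "y \<in> K" for y
      using that \<open>0 < h\<close> by (simp add: g_def a_def exp_minus exp_double power_inverse)
    then have super: "ennreal a * (\<integral>\<^sup>+z. ennreal (exp (w z)) \<partial>P y) \<le> ennreal (exp (w y))"
      if "y \<in> K" for y
      using MPE_solution_exp[OF feller sol, of y] that \<open>l = 0\<close> by simp
    have bound: "exp (- B) \<le> h ^ n * exp B" if "1 \<le> n" for n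
    proof -
      obtain x where "x \<in> K" and x: "ennreal (h ^ n) < emeasure (chain_law P x)
          {\<omega> \<in> space (chain_law P x). hit_time (- K) \<omega> > enat n}" (is "_ < ?p")
        using exit[OF \<open>1 \<le> n\<close>] by (auto simp: less_SUP_iff)
      have "ennreal a ^ n * (ennreal (exp (- B)) * ennreal (h ^ n))
          \<le> ennreal a ^ n * (ennreal (exp (- B)) * ?p)"
        using x by (intro mult_left_mono) auto
      also have "\<dots> \<le> ennreal (exp (w x))"
        using B
        by (intro survival_bound[OF kernel K _ super _ \<open>x \<in> K\<close>] ennreal_leI)
           (auto simp: abs_le_iff minus_le_iff)
      also have "\<dots> \<le> ennreal (exp B)"
        using B by (intro ennreal_leI) (simp add: abs_le_iff)
      finally have "a ^ n * (exp (- B) * h ^ n) \<le> exp B"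
        using \<open>0 < a\<close> \<open>0 < h\<close> by (simp add: ennreal_power flip: ennreal_mult')
      then have "a ^ n * (exp (- B) * h ^ n) * h ^ n \<le> exp B * h ^ n"
        using \<open>0 < h\<close> by (intro mult_right_mono) auto
      moreover have "a ^ n * (exp (- B) * h ^ n) * h ^ n = exp (- B) * (a * h * h) ^ n"
        by (simp add: power_mult_distrib mult_ac)
      moreover have "a * h * h = 1"
        using \<open>0 < h\<close> by (simp add: a_def power2_eq_square field_simps)
      ultimately show ?thesis
        by (simp only: power_one mult_1_right mult.commute[of "exp B" "h ^ n"])
    qed
    have "(\<lambda>n. h ^ n * exp B) \<longlonglongrightarrow> 0 * exp B"
      using \<open>0 < h\<close> \<open>h < 1\<close> by (intro tendsto_mult LIMSEQ_realpow_zero tendsto_const) auto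
    then have "exp (- B) \<le> 0 * exp B"
      by (rule LIMSEQ_le_const) (use bound in blast)
    then show False
      by simp
  qed
  with g show ?thesis
    by blast
qed

end
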